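(* Let $\mathcal{A}$ be a conservative paging algorithm. Let $\alpha=\alpha(k)$ divide $k$, and suppose that $|\mathcal{U}|\ge 16k\exp(8(1-\delta)^{-1}\delta^2\alpha)$ and $(1-\delta)^{-1}\le k/(2\alpha)$ for all large enough $k$. Then, for $c\ge1$, $\alpha$-way set-associative $\mathcal{A}$ is not $c$-competitive with $\mathcal{A}$ using $(1-\delta)^{-1}$-resource augmentation on request sequences of length $O(c\,\alpha\, k\exp(16(1-\delta)^{-1}\delta^2\alpha))$.
   Context: Paging: $\mathcal{U}$ is the universe of items; $\mathcal{A}_k$ is algorithm $\mathcal{A}$ on an initially empty cache of size $k$; $C(\mathcal{A}_k,\sigma)$ is its number of misses on request sequence $\sigma$. A paging algorithm is conservative if it incurs at most $k$ cache misses on any consecutive subsequence of the input containing at most $k$ distinct items. $\alpha$-way set-associative $\mathcal{A}$ with cache size $k$: pick a fully random hash function $h:\mathcal{U}\to[k/\alpha]$, partition the cache into $k/\alpha$ buckets of $\alpha$ slots, run an independent instance of $\mathcal{A}_\alpha$ on each bucket, and serve a request for $x$ in bucket $h(x)$. $\mathcal{A}$ is $c$-competitive with $\mathcal{B}$ with probability $p$ using $r$-resource augmentation on request sequences of length $\ell$ if for every $\sigma$ with $|\sigma|\le\ell$, $\Pr[C(\mathcal{A}_k,\sigma)\le c\,C(\mathcal{B}_{k'},\sigma)+O(1)]\ge p$, where $k=rk'$ (probability over the algorithm's randomness; $\sigma$ chosen by an oblivious adversary). $\mathcal{A}$ is not $c$-competitive with $\mathcal{B}$ using $r$-resource augmentation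 on sequences of length $\ell$ if it is not $c$-competitive with $\mathcal{B}$ with probability $1/2$ in that sense. *)

theory Defs
  imports "HOL-Probability.Probability"
begin

text \<open>A deterministic online algorithm running on a cache of some fixed size is given by the
  cache contents after each finite history of requests. A paging algorithm provides such a
  function for every cache size.\<close>

type_synonym 'u caching = "'u list \<Rightarrow> 'u set"

definition misses :: "'u caching \<Rightarrow> 'u list \<Rightarrow> nat" where
  "misses f \<sigma> = card {i. i < length \<sigma> \<and> \<sigma> ! i \<notin> f (take i \<sigma>)}"

text \<open>Only the requested item may enter the cache, and it must be cached once it has been served;
  evictions are unrestricted. Size 0 is excluded, since no item could be served.\<close>

definition paging_algorithm :: "(nat \<Rightarrow> 'u caching) \<Rightarrow> bool" where
  "paging_algorithm A \<longleftrightarrow>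
     (\<forall>k>0. A k [] = {} \<and>
       (\<forall>\<sigma> x. x \<in> A k (\<sigma> @ [x]) \<and> A k (\<sigma> @ [x]) \<subseteq> insert x (A k \<sigma>)) \<and>
       (\<forall>\<sigma>. finite (A k \<sigma>) \<and> card (A k \<sigma>) \<le> k))"

text \<open>The misses incurred on a segment \<open>\<tau>\<close> requested right after the prefix \<open>\<rho>\<close> number
  \<open>misses (A k) (\<rho> @ \<tau>) - misses (A k) \<rho>\<close>; requests after the segment do not affect them.\<close>

definition conservative :: "(nat \<Rightarrow> 'u caching) \<Rightarrow> bool" where
  "conservative A \<longleftrightarrow>
     (\<forall>k>0. \<forall>\<rho> \<tau>. card (set \<tau>) \<le> k \<longrightarrow> misses (A k) (\<rho> @ \<tau>) \<le> misses (A k) \<rho> + k)"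

text \<open>Bucket \<open>b\<close> runs its own instance of \<open>A a\<close> on the requests hashed to \<open>b\<close>; the cache consists
  of the contents of all \<open>k div a\<close> buckets.\<close>

definition set_associative ::
  "(nat \<Rightarrow> 'u caching) \<Rightarrow> nat \<Rightarrow> nat \<Rightarrow> ('u \<Rightarrow> nat) \<Rightarrow> 'u caching" where
  "set_associative A a k h \<sigma> = (\<Union>b<k div a. A a (filter (\<lambda>x. h x = b) \<sigma>))"

definition random_hash :: "'u set \<Rightarrow> nat \<Rightarrow> ('u \<Rightarrow> nat) measure" where
  "random_hash U m = PiM U (\<lambda>_. uniform_count_measure {..<m})"

text \<open>\<open>\<A> k \<omega>\<close> is the randomized algorithm on a cache of size \<open>k\<close> when its random choices, drawn
  from \<open>M k\<close>, are \<open>\<omega>\<close>. The universe \<open>U\<close>, the augmentation \<open>r\<close> and the length bound \<open>l\<close> may depend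
  on \<open>k\<close>, and the additive term \<open>O(1)\<close> is a constant \<open>D\<close> independent of \<open>k\<close> and \<open>\<sigma>\<close>. Sizes \<open>k\<close> for
  which \<open>k = r k'\<close> has no integral solution \<open>k'\<close> impose no condition.\<close>

definition competitive_with_prob ::
  "(nat \<Rightarrow> 'u set) \<Rightarrow> (nat \<Rightarrow> 'w measure) \<Rightarrow> (nat \<Rightarrow> 'w \<Rightarrow> 'u caching) \<Rightarrow> (nat \<Rightarrow> 'u caching) \<Rightarrow>
   real \<Rightarrow> real \<Rightarrow> (nat \<Rightarrow> real) \<Rightarrow> (nat \<Rightarrow> real) \<Rightarrow> bool" where
  "competitive_with_prob U M \<A> \<B> c p r l \<longleftrightarrow>
     (\<exists>D::real. \<forall>\<^sub>F k in sequentially. \<forall>k'. real k = r k * real k' \<longrightarrow>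
        (\<forall>\<sigma>. set \<sigma> \<subseteq> U k \<and> real (length \<sigma>) \<le> l k \<longrightarrow>
           measure (M k) {\<omega> \<in> space (M k).
             real (misses (\<A> k \<omega>) \<sigma>) \<le> c * real (misses (\<B> k') \<sigma>) + D} \<ge> p))"

definition not_competitive ::
  "(nat \<Rightarrow> 'u set) \<Rightarrow> (nat \<Rightarrow> 'w measure) \<Rightarrow> (nat \<Rightarrow> 'w \<Rightarrow> 'u caching) \<Rightarrow> (nat \<Rightarrow> 'u caching) \<Rightarrow>
   real \<Rightarrow> (nat \<Rightarrow> real) \<Rightarrow> (nat \<Rightarrow> real) \<Rightarrow> bool" where
  "not_competitive U M \<A> \<B> c r l \<longleftrightarrow> \<not> competitive_with_prob U M \<A> \<B> c (1/2) r l"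

end

theory Submission
  imports Defs
begin

text \<open>
  Write \<open>m = k / \<alpha>\<close> for the number of buckets and \<open>e = (1 - \<delta>)\<inverse> \<delta>\<^sup>2 \<alpha>\<close>. The adversary takes about
  \<open>16 (1 - \<delta>)\<inverse> exp (8 e)\<close> disjoint blocks of \<open>k'\<close> items and cycles \<open>R\<close> times through each block
  before moving on to the next. A conservative algorithm with a cache of size \<open>k'\<close> misses at most \<open>k'\<close> times
  per block, whereas a bucket receiving more than \<open>\<alpha>\<close> items of some block misses on every pass
  through that block.

  The load of a bucket from one block is binomial with \<open>k'\<close> trials and mean \<open>(1 - \<delta>) \<alpha>\<close>. With
  success probability \<open>\<alpha> / k'\<close> instead of \<open>\<alpha> / k\<close> the mean would be the integer \<open>\<alpha>\<close>, and the load would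
  exceed it with probability at least \<open>2 / 9\<close>; the Cauchy-Schwarz inequality transfers this to a bound
  \<open>4 / 81 exp (- 2 e)\<close> for the true load. The blocks being independent, a given bucket is never
  overloaded with probability at most \<open>12 / 25\<close>. Markov's inequality over the buckets then makes at
  least three percent of them overloaded with probability more than \<open>1 / 2\<close>, which
  costs \<open>3 R m / 100\<close> misses and exceeds the allowance once \<open>R\<close> is large enough.
\<close>

section \<open>Tails of the binomial distribution\<close>

text \<open>An explicit formula instead of a probability mass function keeps the recurrences below
  purely algebraic. It sums to 1 for every real \<open>p\<close>, by the binomial theorem.\<close>

definition binom_prob :: "nat \<Rightarrow> real \<Rightarrow> nat \<Rightarrow> real" where
  "binom_prob n p j = real (n choose j) * p ^ j * (1 - p) ^ (n - j)"

lemma binom_prob_nonneg: "0 \<le> p \<Longrightarrow> p \<le> 1 \<Longrightarrow> 0 \<le> binom_prob n p j"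
  by (simp add: binom_prob_def)

lemma sum_binom_prob: "(\<Sum>j\<le>n. binom_prob n p j) = 1"
  using binomial_ring[of p "1 - p" n] by (simp add: binom_prob_def)

lemma binom_prob_Suc:
  assumes "j < n"
  shows "binom_prob n p (Suc j) * real (Suc j) * (1 - p) = binom_prob n p j * real (n - j) * p"
proof -
  have "Suc j * (n choose Suc j) = (n - j) * (n choose j)"
    by (metis binomial_absorb_comp binomial_absorption)
  then have *: "real (Suc j) * real (n choose Suc j) = real (n - j) * real (n choose j)"
    by (metis of_nat_mult)
  have **: "(1 - p) ^ (n - j) = (1 - p) ^ (n - Suc j) * (1 - p)"
    using assms by (metis Suc_diff_Suc power_Suc2)
  have "binom_prob n p (Suc j) * real (Suc j) * (1 - p)
      = (real (Suc j) * real (n choose Suc j)) * p ^ j * p * ((1 - p) ^ (n - Suc j) * (1 - p))"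
    by (simp add: binom_prob_def del: of_nat_Suc)
  also have "\<dots> = binom_prob n p j * real (n - j) * p"
    unfolding * **[symmetric] by (simp add: binom_prob_def)
  finally show ?thesis .
qed

text \<open>Cauchy-Schwarz, after writing each mass under \<open>r\<close> as the square root of the
  mass under \<open>p\<close> times a quotient. The squared quotients sum to at most 1 plus the
  chi-square divergence of the two binomial laws, which tensorizes over the \<open>n\<close>
  trials.\<close>

lemma binom_prob_tail_change_of_measure:
  fixes p r :: real
  assumes p: "0 < p" "p < 1" and r: "0 \<le> r" "r \<le> 1" and J: "J \<subseteq> {..n}"
  shows "(\<Sum>j\<in>J. binom_prob n r j)\<^sup>2
    \<le> (\<Sum>j\<in>J. binom_prob n p j) * (1 + (r - p)\<^sup>2 / (p * (1 - p))) ^ n"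
proof -
  have pos: "binom_prob n p j > 0" if "j \<in> J" for j
    using that J p by (auto simp: binom_prob_def)
  define g where "g j = binom_prob n r j / sqrt (binom_prob n p j)" for j
  \<comment> \<open>\<open>w j\<close> is the squared mass under \<open>r\<close> divided by the
    mass under \<open>p\<close>, arranged as a term of a binomial expansion.\<close>
  define w where "w j = real (n choose j) * (r\<^sup>2 / p) ^ j * ((1 - r)\<^sup>2 / (1 - p)) ^ (n - j)" for j
  have g2: "(g j)\<^sup>2 = w j" if "j \<in> J" for j
  proof -
    have comm: "(x\<^sup>2) ^ i = (x ^ i)\<^sup>2" for x :: real and i
      by (simp add: power_mult[symmetric] mult.commute)
    define C P P' R R' where "C = real (n choose j)" and "P = p ^ j" and "P' = (1 - p) ^ (n - j)"
      and "R = r ^ j" and "R' = (1 - r) ^ (n - j)"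
    have nz: "C \<noteq> 0" "P \<noteq> 0" "P' \<noteq> 0" using that J p by (auto simp: C_def P_def P'_def)
    have "(g j)\<^sup>2 = (C * R * R')\<^sup>2 / (C * P * P')"
      using pos[OF that] by (simp add: g_def power_divide binom_prob_def C_def P_def P'_def R_def R'_def)
    also have "\<dots> = C * (R\<^sup>2 / P) * (R'\<^sup>2 / P')"
      using nz by (simp add: power2_eq_square field_simps)
    also have "\<dots> = w j"
      by (simp add: w_def power_divide comm C_def P_def P'_def R_def R'_def)
    finally show ?thesis .
  qed
  have "(\<Sum>j\<in>J. binom_prob n r j) = (\<Sum>j\<in>J. sqrt (binom_prob n p j) * g j)"
  proof (rule sum.cong)
    fix j assume "j \<in> J"
    then show "binom_prob n r j = sqrt (binom_prob n p j) * g j"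
      using pos[of j] by (simp add: g_def)
  qed simp
  also have "\<dots>\<^sup>2 \<le> (\<Sum>j\<in>J. (sqrt (binom_prob n p j))\<^sup>2) * (\<Sum>j\<in>J. (g j)\<^sup>2)"
    by (rule Cauchy_Schwarz_ineq_sum)
  also have "(\<Sum>j\<in>J. (sqrt (binom_prob n p j))\<^sup>2) = (\<Sum>j\<in>J. binom_prob n p j)"
    by (rule sum.cong) (use pos in \<open>auto simp: less_imp_le\<close>)
  also have "(\<Sum>j\<in>J. (g j)\<^sup>2) = (\<Sum>j\<in>J. w j)"
    by (rule sum.cong) (use g2 in auto)
  finally have *: "(\<Sum>j\<in>J. binom_prob n r j)\<^sup>2 \<le> (\<Sum>j\<in>J. binom_prob n p j) * (\<Sum>j\<in>J. w j)" .
  \<comment> \<open>Only the sum over all \<open>j\<close> has a closed form. Its base simplifies to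
    1 plus the chi-square divergence of two Bernoulli laws.\<close>
  have "(\<Sum>j\<in>J. w j) \<le> (\<Sum>j\<le>n. w j)"
    by (rule sum_mono2) (use J p in \<open>auto simp: w_def\<close>)
  also have "\<dots> = (r\<^sup>2 / p + (1 - r)\<^sup>2 / (1 - p)) ^ n"
    unfolding w_def by (rule binomial_ring[symmetric])
  also have "r\<^sup>2 / p + (1 - r)\<^sup>2 / (1 - p) = 1 + (r - p)\<^sup>2 / (p * (1 - p))"
    using p by (simp add: field_simps power2_eq_square)
  finally have "(\<Sum>j\<in>J. w j) \<le> (1 + (r - p)\<^sup>2 / (p * (1 - p))) ^ n" .
  then show ?thesis
    using * by (smt (verit) mult_left_mono sum_nonneg pos)
qed

section \<open>The upper tail of a binomial law with integer mean\<close>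

lemma binom_prob_Suc_integer_mean:
  assumes "a \<le> n" and "j < n"
  shows "binom_prob n (real a / real n) (Suc j) * real (Suc j) * real (n - a)
    = binom_prob n (real a / real n) j * real (n - j) * real a"
proof -
  have p: "1 - real a / real n = real (n - a) / real n"
    using assms by (simp add: of_nat_diff field_simps)
  show ?thesis
    using binom_prob_Suc[OF assms(2), of "real a / real n"] assms unfolding p
    by (simp add: field_simps)
qed

text \<open>Reflection about \<open>a - 1/2\<close>. Moving away from the centre, the masses on the
  left shrink at least as fast as those on the right, because the success probability is at most
  1/2; the induction on \<open>i\<close> compares these ratios by the recurrence.\<close>

lemma binom_prob_reflect:
  assumes a: "0 < a" "2 * a \<le> n" and i: "i < a"
  shows "binom_prob n (real a / real n) (a - 1 - i) \<le> binom_prob n (real a / real n) (a + i)"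
proof -
  define N where "N = n - a"
  have N: "N \<ge> a" "n = a + N" using a by (auto simp: N_def)
  define b where "b = binom_prob n (real a / real n)"
  have b0: "b j \<ge> 0" for j unfolding b_def by (rule binom_prob_nonneg) (use a in auto)
  have rec: "b (Suc j) * real (Suc j) * real N = b j * real (n - j) * real a" if "j < n" for j
    using binom_prob_Suc_integer_mean[of a n j] that a by (simp add: b_def N_def)
  have "b (a - 1 - i) \<le> b (a + i)"
    using i
  proof (induction i)
    case 0
    have "real a * (b a * real N) = real a * (b (a - 1) * real (N + 1))"
      using rec[of "a - 1"] a N by (simp add: algebra_simps)
    then have "b a * real N = b (a - 1) * real (N + 1)"
      using a by (simp only: mult_cancel_left) simp
    then have "b (a - 1) * real (N + 1) \<le> b a * real (N + 1)"
      using b0[of a] by (simp add: algebra_simps)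
    then show ?case by simp
  next
    case (Suc i)
    define A M t where "A = real a" and "M = real N" and "t = real (Suc i)"
    have AM: "0 < A" "A \<le> M" "0 < t" "t < A" using a N Suc by (auto simp: A_def M_def t_def)
    have up: "b (a + Suc i) * (A + t) * M = b (a + i) * (M + 1 - t) * A"
      using rec[of "a + i"] Suc.prems N
      by (simp add: A_def M_def t_def of_nat_diff add_ac)
    have "Suc (a - 1 - Suc i) = a - 1 - i" using Suc.prems by simp
    then have dn: "b (a - 1 - i) * (A - t) * M = b (a - 1 - Suc i) * (M + 1 + t) * A"
      using rec[of "a - 1 - Suc i"] Suc.prems N
      by (simp add: A_def M_def t_def of_nat_diff algebra_simps)
    have IH: "b (a - 1 - i) \<le> b (a + i)" using Suc by simp
    have "t\<^sup>2 * A\<^sup>2 \<le> t\<^sup>2 * M\<^sup>2" using AM by (intro mult_left_mono power_mono) auto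
    moreover have "0 \<le> A\<^sup>2 * (2 * M + 1)" using AM by simp
    \<comment> \<open>The difference of the two sides is \<open>A\<^sup>2 * (2 * M + 1) + t\<^sup>2
      * (M\<^sup>2 - A\<^sup>2)\<close>, which is nonnegative as \<open>A \<le> M\<close>.\<close>
    ultimately have key: "(A - t) * (A + t) * M\<^sup>2 \<le> (M + 1 - t) * (M + 1 + t) * A\<^sup>2"
      by (simp add: algebra_simps power2_eq_square)
    have "b (a - 1 - Suc i) * ((M + 1 + t) * A * (A + t) * M)
        = (b (a - 1 - Suc i) * (M + 1 + t) * A) * ((A + t) * M)"
      by (simp only: mult_ac)
    also have "\<dots> = b (a - 1 - i) * ((A - t) * (A + t) * M\<^sup>2)"
      unfolding dn[symmetric] by (simp only: power2_eq_square mult_ac)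
    also have "\<dots> \<le> b (a + i) * ((M + 1 - t) * (M + 1 + t) * A\<^sup>2)"
      by (rule mult_mono[OF IH key b0]) (use AM in auto)
    also have "\<dots> = (b (a + i) * (M + 1 - t) * A) * ((M + 1 + t) * A)"
      by (simp only: power2_eq_square mult_ac)
    also have "\<dots> = b (a + Suc i) * ((M + 1 + t) * A * (A + t) * M)"
      unfolding up[symmetric] by (simp only: mult_ac)
    finally show ?case
      using AM by (subst (asm) mult_le_cancel_right_pos) auto
  qed
  then show ?thesis by (simp add: b_def)
qed

text \<open>All mass outside the tail is charged to the tail \<open>T\<close>: what lies below
  \<open>a - 1\<close> by reflection, and the two central masses through the recurrence, which
  bounds them by multiples of the first two tail masses.\<close>

lemma binom_prob_tail_integer_mean:
  assumes a: "0 < a" "2 * a \<le> n"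
  shows "2 / 9 \<le> (\<Sum>j\<in>{a<..n}. binom_prob n (real a / real n) j)"
proof -
  define b where "b = binom_prob n (real a / real n)"
  define T where "T = (\<Sum>j\<in>{a<..n}. b j)"
  define N where "N = n - a"
  have N: "N \<ge> a" "n = a + N" using a by (auto simp: N_def)
  have b0: "b j \<ge> 0" for j unfolding b_def by (rule binom_prob_nonneg) (use a in auto)
  have rec: "b (Suc j) * real (Suc j) * real N = b j * real (n - j) * real a" if "j < n" for j
    using binom_prob_Suc_integer_mean[of a n j] that a by (simp add: b_def N_def)
  have b_le: "b (a - 1) \<le> b a" using binom_prob_reflect[of a n 0] a by (simp add: b_def)
  have "{..n} = {..<a - 1} \<union> ({a - 1, a} \<union> {a<..n})" using a by auto
  moreover have "{..<a - 1} \<inter> ({a - 1, a} \<union> {a<..n}) = {}" "{a - 1, a} \<inter> {a<..n} = {}" by auto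
  ultimately have "(\<Sum>j\<le>n. b j) = (\<Sum>j<a - 1. b j) + ((\<Sum>j\<in>{a - 1, a}. b j) + T)"
    unfolding T_def by (simp only: sum.union_disjoint finite_lessThan finite_Un finite.intros finite_greaterThanAtMost simp_thms)
  then have tot: "1 = (\<Sum>j<a - 1. b j) + b (a - 1) + b a + T"
    using a sum_binom_prob[of n] by (simp add: b_def)
  have bSa: "b (Suc a) * real (Suc a) = b a * real a"
    using rec[of a] N a by simp
  have T_ge2: "b (Suc a) + b (Suc (Suc a)) \<le> T" if "a + 2 \<le> n"
  proof -
    have "(\<Sum>j\<in>{Suc a, Suc (Suc a)}. b j) \<le> T" unfolding T_def
      by (rule sum_mono2) (use that b0 in auto)
    then show ?thesis by simp
  qed
  have bSSa: "b (Suc (Suc a)) * real (Suc (Suc a)) * real N = b (Suc a) * (real N - 1) * real a" 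
    if "a + 2 \<le> n"
    using rec[of "Suc a"] that N a by (simp add: of_nat_diff)
  have "2 / 9 \<le> T"
  \<comment> \<open>The general estimate \<open>2 * b a \<le> 3 * b (Suc a)\<close> fails here,
    since \<open>b 1 = 2 * b 2\<close>; in return there is no mass below \<open>a - 1\<close>. For
    \<open>n = 2\<close> the tail is exactly 1/4.\<close>
  proof (cases "a = 1")
    case True
    show ?thesis
    proof (cases "n = 2")
      case True
      have "{Suc 0<..2} = {2::nat}" by auto
      then show ?thesis using True \<open>a = 1\<close> by (simp add: T_def b_def binom_prob_def power2_eq_square)
    next
      case False
      then have n: "a + 2 \<le> n" using a True by simp
      have "N \<ge> 2" using n N True by simp
      have 1: "b 2 * 2 = b 1" using bSa True by (simp add: numeral_2_eq_2)
      have "b 3 * 3 * real N = b 2 * (real N - 1)" using bSSa[OF n] True by (simp add: numeral_2_eq_2 numeral_3_eq_3)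
      moreover have "b 2 * real N \<le> b 2 * (2 * (real N - 1))" 
        using \<open>N \<ge> 2\<close> b0[of 2] by (intro mult_left_mono) auto
      ultimately have "(b 3 * 6) * real N \<ge> b 2 * real N" by (simp add: algebra_simps)
      then have "b 3 * 6 \<ge> b 2" using \<open>N \<ge> 2\<close> by simp
      moreover have "b 2 + b 3 \<le> T" using T_ge2[OF n] True by (simp add: numeral_2_eq_2 numeral_3_eq_3)
      moreover have "1 = b 0 + b 1 + T" "b 0 \<le> b 1" using tot b_le True by auto
      \<comment> \<open>With \<open>b 2 \<le> 6 * b 3\<close> one gets
        \<open>2 * b 1 = 4 * b 2 \<le> 24/7 * T\<close>, hence \<open>T \<ge> 7/31\<close>.\<close>
      ultimately show ?thesis using 1 by linarith
    qed
  next
    case False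
    then have a2: "a \<ge> 2" "N \<ge> 2" using a N by auto
    then have n: "a + 2 \<le> n" using a by simp
    have "(\<Sum>j<a - 1. b j) = (\<Sum>i<a - 1. b (a - 1 - Suc i))"
      by (rule sum.nat_diff_reindex[symmetric])
    also have "\<dots> \<le> (\<Sum>i<a - 1. b (a + Suc i))"
    proof (rule sum_mono)
      fix i assume "i \<in> {..<a - 1}"
      then show "b (a - 1 - Suc i) \<le> b (a + Suc i)"
        unfolding b_def by (intro binom_prob_reflect[OF a]) auto
    qed
    also have "\<dots> = (\<Sum>j\<in>(\<lambda>i. a + Suc i) ` {..<a - 1}. b j)"
      by (subst sum.reindex) (auto simp: inj_on_def)
    also have "\<dots> \<le> T" unfolding T_def
      by (rule sum_mono2) (use a b0 in auto)
    finally have half: "(\<Sum>j<a - 1. b j) \<le> T" .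
    have "b a * 2 * real (Suc a) \<le> b a * (3 * real a)"
      using a2 b0[of a] by (simp add: mult.assoc mult_left_mono)
    then have "b a * 2 * real (Suc a) \<le> b (Suc a) * 3 * real (Suc a)" using bSa by (simp add: algebra_simps)
    then have 1: "b a * 2 \<le> b (Suc a) * 3" by (simp del: of_nat_Suc)
    have "real (Suc (Suc a)) * real N \<le> 4 * ((real N - 1) * real a)"
    proof -
      have "0 \<le> (real a - 2) * (real N - 2)" using a2 by simp
      moreover have "0 \<le> (real N - real a) * 2 + (real a - 2) * real N * 2" using a2 N by simp
      ultimately show ?thesis using a2 N by (simp add: algebra_simps)
    qed
    then have "b (Suc a) * (real (Suc (Suc a)) * real N) \<le> b (Suc a) * (4 * ((real N - 1) * real a))"
      using b0 by (intro mult_left_mono) auto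
    also have "\<dots> = (b (Suc (Suc a)) * 4) * (real (Suc (Suc a)) * real N)"
      using bSSa[OF n] by (simp add: algebra_simps)
    finally have 2: "b (Suc a) \<le> b (Suc (Suc a)) * 4"
      using a2 by (simp del: of_nat_Suc)
    \<comment> \<open>Facts 1 and 2 give \<open>2 * b a \<le> 3 * b (Suc a) \<le> 12/5 * T\<close>,
      so \<open>1 \<le> 2 * T + 2 * b a \<le> 22/5 * T\<close> and
      \<open>T \<ge> 5/22\<close>.\<close>
    show ?thesis using 1 2 T_ge2[OF n] tot half b_le by linarith
  qed
  then show ?thesis by (simp add: T_def b_def)
qed

section \<open>Cyclic request sequences\<close>

lemma misses_Nil [simp]: "misses f [] = 0"
  by (simp add: misses_def)

lemma misses_snoc: "misses f (\<sigma> @ [x]) = misses f \<sigma> + of_bool (x \<notin> f \<sigma>)"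
proof -
  let ?S = "{i. i < length \<sigma> \<and> \<sigma> ! i \<notin> f (take i \<sigma>)}"
  have "{i. i < length (\<sigma> @ [x]) \<and> (\<sigma> @ [x]) ! i \<notin> f (take i (\<sigma> @ [x]))}
      = ?S \<union> (if x \<notin> f \<sigma> then {length \<sigma>} else {})"
    by (auto simp: nth_append less_Suc_eq)
  then show ?thesis
    by (simp add: misses_def)
qed

lemma misses_append_mono: "misses f \<rho> \<le> misses f (\<rho> @ \<tau>)"
proof (induction \<tau> rule: rev_induct)
  case (snoc x \<tau>)
  then show ?case using misses_snoc[of f "\<rho> @ \<tau>" x] by simp
qed simp

lemma paging_cache_append_subset:
  assumes "paging_algorithm A" and "0 < k"
  shows "A k (\<rho> @ \<tau>) \<subseteq> A k \<rho> \<union> set \<tau>"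
proof (induction \<tau> rule: rev_induct)
  case (snoc x \<tau>)
  have "A k ((\<rho> @ \<tau>) @ [x]) \<subseteq> insert x (A k (\<rho> @ \<tau>))"
    using assms unfolding paging_algorithm_def by blast
  with snoc show ?case by auto
qed simp

lemma paging_cache_subset:
  assumes "paging_algorithm A" and "0 < k"
  shows "A k \<tau> \<subseteq> set \<tau>"
  using paging_cache_append_subset[OF assms, of "[]" \<tau>] assms by (auto simp: paging_algorithm_def)

text \<open>By pigeonhole some item of the pass is absent from the cache when the pass starts. Only
  requested items enter and the pass has no repetition, so that item is still absent when its turn
  comes.\<close>

lemma misses_overfull_pass:
  assumes A: "paging_algorithm A" "0 < k" and \<tau>: "distinct \<tau>" "k < length \<tau>"
  shows "Suc (misses (A k) \<rho>) \<le> misses (A k) (\<rho> @ \<tau>)"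
proof -
  have fin: "finite (A k \<rho>)" "card (A k \<rho>) \<le> k"
    using A by (auto simp: paging_algorithm_def)
  have "\<not> set \<tau> \<subseteq> A k \<rho>"
  proof
    assume "set \<tau> \<subseteq> A k \<rho>"
    then have "card (set \<tau>) \<le> k" using card_mono[OF fin(1)] fin(2) le_trans by blast
    then show False using \<tau> by (simp add: distinct_card)
  qed
  then obtain x where x: "x \<in> set \<tau>" "x \<notin> A k \<rho>" by auto
  then obtain \<tau>1 \<tau>2 where split: "\<tau> = \<tau>1 @ x # \<tau>2" by (meson split_list)
  then have "x \<notin> A k (\<rho> @ \<tau>1)"
    using x(2) \<tau>(1) paging_cache_append_subset[OF A, of \<rho> \<tau>1] by auto
  then have "misses (A k) (\<rho> @ \<tau>1 @ [x]) = Suc (misses (A k) (\<rho> @ \<tau>1))"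
    using misses_snoc[of "A k" "\<rho> @ \<tau>1" x] by simp
  moreover have "misses (A k) \<rho> \<le> misses (A k) (\<rho> @ \<tau>1)" by (rule misses_append_mono)
  moreover have "misses (A k) (\<rho> @ \<tau>1 @ [x]) \<le> misses (A k) (\<rho> @ \<tau>)"
    using misses_append_mono[of "A k" "\<rho> @ \<tau>1 @ [x]" \<tau>2] by (simp add: split)
  ultimately show ?thesis by simp
qed

lemma misses_overfull_passes:
  assumes A: "paging_algorithm A" "0 < k" and \<tau>: "distinct \<tau>" "k < length \<tau>"
  shows "misses (A k) \<rho> + R \<le> misses (A k) (\<rho> @ concat (replicate R \<tau>))"
proof (induction R)
  case (Suc R)
  have "concat (replicate (Suc R) \<tau>) = concat (replicate R \<tau>) @ \<tau>"
    by (metis concat.simps concat_append append_Nil2 replicate_Suc replicate_append_same)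
  then show ?case
    using Suc misses_overfull_pass[OF assms, of "\<rho> @ concat (replicate R \<tau>)"] by simp
qed simp

section \<open>Cycling repeatedly through a list of blocks\<close>

definition cycle_blocks :: "nat \<Rightarrow> 'u list list \<Rightarrow> 'u list" where
  "cycle_blocks R \<tau>s = concat (map (\<lambda>\<tau>. concat (replicate R \<tau>)) \<tau>s)"

lemma cycle_blocks_append: "cycle_blocks R (\<tau>s @ \<tau>s') = cycle_blocks R \<tau>s @ cycle_blocks R \<tau>s'"
  by (simp add: cycle_blocks_def)

lemma set_cycle_blocks: "set (cycle_blocks R \<tau>s) \<subseteq> (\<Union>\<tau>\<in>set \<tau>s. set \<tau>)"
  by (auto simp: cycle_blocks_def)

lemma length_cycle_blocks:
  "(\<And>\<tau>. \<tau> \<in> set \<tau>s \<Longrightarrow> length \<tau> = n) \<Longrightarrow> length (cycle_blocks R \<tau>s) = length \<tau>s * (R * n)"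
proof (induction \<tau>s)
  case (Cons \<tau> \<tau>s)
  have "length (concat (replicate R \<tau>)) = R * length \<tau>"
    by (induction R) simp_all
  with Cons show ?case by (simp add: cycle_blocks_def)
qed (simp add: cycle_blocks_def)

lemma filter_cycle_blocks: "filter P (cycle_blocks R \<tau>s) = cycle_blocks R (map (filter P) \<tau>s)"
  unfolding cycle_blocks_def by (simp only: filter_concat map_map comp_def map_replicate)

text \<open>All \<open>R\<close> passes through one block form a single segment with at most
  \<open>k\<close> distinct items, so the cost per block is at most \<open>k\<close> whatever
  \<open>R\<close> is.\<close>

lemma conservative_cycle_blocks:
  assumes "conservative A" and "0 < k" and "\<And>\<tau>. \<tau> \<in> set \<tau>s \<Longrightarrow> length \<tau> \<le> k"
  shows "misses (A k) (cycle_blocks R \<tau>s) \<le> length \<tau>s * k"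
  using assms(3)
proof (induction \<tau>s rule: rev_induct)
  case (snoc \<tau> \<tau>s)
  have "card (set (cycle_blocks R [\<tau>])) \<le> card (set \<tau>)"
    by (rule card_mono) (auto simp: cycle_blocks_def)
  also have "\<dots> \<le> k"
    using snoc.prems[of \<tau>] card_length[of \<tau>] by simp
  finally have "misses (A k) (cycle_blocks R \<tau>s @ cycle_blocks R [\<tau>]) \<le> misses (A k) (cycle_blocks R \<tau>s) + k"
    using assms(1,2) unfolding conservative_def by blast
  then show ?case using snoc by (simp add: cycle_blocks_append)
qed (simp add: cycle_blocks_def)

lemma misses_cycle_blocks_overfull:
  assumes A: "paging_algorithm A" "0 < k" and \<tau>: "\<tau> \<in> set \<tau>s" "distinct \<tau>" "k < length \<tau>"
  shows "R \<le> misses (A k) (cycle_blocks R \<tau>s)"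
proof -
  obtain \<tau>s1 \<tau>s2 where "\<tau>s = \<tau>s1 @ \<tau> # \<tau>s2" using \<tau>(1) by (meson split_list)
  then have "cycle_blocks R \<tau>s = (cycle_blocks R \<tau>s1 @ concat (replicate R \<tau>)) @ cycle_blocks R \<tau>s2"
    by (simp add: cycle_blocks_def)
  then show ?thesis
    using misses_append_mono[of "A k" "cycle_blocks R \<tau>s1 @ concat (replicate R \<tau>)" "cycle_blocks R \<tau>s2"]
      misses_overfull_passes[OF A \<tau>(2,3), of "cycle_blocks R \<tau>s1" R] by simp
qed

text \<open>A bucket only ever contains items hashed to it, so a request for \<open>x\<close> hits
  exactly when the instance in bucket \<open>h x\<close> holds \<open>x\<close>. Every miss is thus
  a miss of exactly one bucket.\<close>

lemma misses_set_associative: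
  assumes A: "paging_algorithm A" "0 < a" and h: "\<And>x. x \<in> set \<sigma> \<Longrightarrow> h x < k div a"
  shows "misses (set_associative A a k h) \<sigma> = (\<Sum>b<k div a. misses (A a) (filter (\<lambda>x. h x = b) \<sigma>))"
  using h
proof (induction \<sigma> rule: rev_induct)
  case (snoc x \<sigma>)
  let ?F = "\<lambda>b. filter (\<lambda>x. h x = b) \<sigma>"
  have hx: "h x < k div a" using snoc.prems by simp
  have "x \<in> set_associative A a k h \<sigma> \<longleftrightarrow> x \<in> A a (?F (h x))"
    using hx paging_cache_subset[OF A, of "?F _"] by (fastforce simp: set_associative_def)
  moreover have "(\<Sum>b<k div a. misses (A a) (filter (\<lambda>x. h x = b) (\<sigma> @ [x])))
      = (\<Sum>b<k div a. misses (A a) (?F b) + (if b = h x then of_bool (x \<notin> A a (?F (h x))) else 0))"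
    by (rule sum.cong) (auto simp: misses_snoc)
  ultimately show ?case
    using snoc hx by (simp add: misses_snoc sum.distrib)
qed simp

definition overloads :: "nat \<Rightarrow> ('u \<Rightarrow> nat) \<Rightarrow> nat \<Rightarrow> 'u set \<Rightarrow> bool" where
  "overloads a h b S \<longleftrightarrow> a < card {x \<in> S. h x = b}"

text \<open>Filtering commutes with cycling: a bucket sees a cyclic sequence over its share of each
  block. If one share exceeds \<open>a\<close> items, the bucket misses on each of the
  \<open>R\<close> passes through it.\<close>

lemma misses_set_associative_cycle_blocks:
  assumes A: "paging_algorithm A" "0 < a"
    and \<tau>s: "\<And>\<tau>. \<tau> \<in> set \<tau>s \<Longrightarrow> distinct \<tau>"
    and h: "\<And>\<tau> x. \<tau> \<in> set \<tau>s \<Longrightarrow> x \<in> set \<tau> \<Longrightarrow> h x < k div a"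
  shows "R * card {b. b < k div a \<and> (\<exists>\<tau>\<in>set \<tau>s. overloads a h b (set \<tau>))}
    \<le> misses (set_associative A a k h) (cycle_blocks R \<tau>s)"
proof -
  let ?B = "{b. b < k div a \<and> (\<exists>\<tau>\<in>set \<tau>s. overloads a h b (set \<tau>))}"
  let ?F = "\<lambda>b. filter (\<lambda>x. h x = b) (cycle_blocks R \<tau>s)"
  have "R \<le> misses (A a) (?F b)" if bB: "b \<in> ?B" for b
  proof -
    obtain \<tau> where \<tau>: "\<tau> \<in> set \<tau>s" "a < card {x \<in> set \<tau>. h x = b}"
      using bB unfolding overloads_def by blast
    show ?thesis unfolding filter_cycle_blocks
    proof (rule misses_cycle_blocks_overfull[OF A])
      show "filter (\<lambda>x. h x = b) \<tau> \<in> set (map (filter (\<lambda>x. h x = b)) \<tau>s)" using \<tau> by simp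
      show d: "distinct (filter (\<lambda>x. h x = b) \<tau>)" using \<tau> \<tau>s by simp
      show "a < length (filter (\<lambda>x. h x = b) \<tau>)"
        using \<tau>(2) distinct_card[OF d] by simp
    qed
  qed
  then have "R * card ?B \<le> (\<Sum>b\<in>?B. misses (A a) (?F b))"
    using sum_bounded_below[of ?B R] by (simp add: mult.commute)
  also have "\<dots> \<le> (\<Sum>b<k div a. misses (A a) (?F b))"
    by (rule sum_mono2) auto
  also have "\<dots> = misses (set_associative A a k h) (cycle_blocks R \<tau>s)"
    using set_cycle_blocks[of R \<tau>s] h by (intro misses_set_associative[symmetric] A) blast
  finally show ?thesis .
qed

section \<open>Random bucket loads\<close>

text \<open>For \<open>B \<subseteq> T\<close>, the probability that a random subset of
  \<open>T\<close>, containing each element independently with probability \<open>p\<close>, equals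
  \<open>B\<close>. Finite sums of these weights replace a product measure on subsets.\<close>

definition subset_weight :: "real \<Rightarrow> 'u set \<Rightarrow> 'u set \<Rightarrow> real" where
  "subset_weight p T B = p ^ card B * (1 - p) ^ card (T - B)"

text \<open>Independence over disjoint ground sets: a subset of the union is a pair of subsets, and
  the weight factors along this bijection.\<close>

lemma sum_subset_weight_union:
  assumes "finite S" "finite T" and "S \<inter> T = {}"
  shows "(\<Sum>B | B \<subseteq> S \<union> T \<and> P (B \<inter> S) \<and> Q (B \<inter> T). subset_weight p (S \<union> T) B)
    = (\<Sum>B | B \<subseteq> S \<and> P B. subset_weight p S B) * (\<Sum>B | B \<subseteq> T \<and> Q B. subset_weight p T B)"
proof -
  have "(\<Sum>B | B \<subseteq> S \<and> P B. subset_weight p S B) * (\<Sum>B | B \<subseteq> T \<and> Q B. subset_weight p T B)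
    = (\<Sum>(B, C)\<in>{B. B \<subseteq> S \<and> P B} \<times> {B. B \<subseteq> T \<and> Q B}. subset_weight p S B * subset_weight p T C)"
    unfolding sum_product by (rule sum.cartesian_product)
  also have "\<dots> = (\<Sum>B | B \<subseteq> S \<union> T \<and> P (B \<inter> S) \<and> Q (B \<inter> T). subset_weight p (S \<union> T) B)"
  proof (rule sum.reindex_bij_witness[where i = "\<lambda>B. (B \<inter> S, B \<inter> T)" and j = "\<lambda>(B, C). B \<union> C"])
    fix BC assume "BC \<in> {B. B \<subseteq> S \<and> P B} \<times> {B. B \<subseteq> T \<and> Q B}"
    then obtain B C where BC: "BC = (B, C)" "B \<subseteq> S" "P B" "C \<subseteq> T" "Q C" by auto
    have eq: "(B \<union> C) \<inter> S = B" "(B \<union> C) \<inter> T = C" using BC assms(3) by blast+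
    show "((case BC of (B, C) \<Rightarrow> B \<union> C) \<inter> S, (case BC of (B, C) \<Rightarrow> B \<union> C) \<inter> T) = BC"
      using BC eq by simp
    show "(case BC of (B, C) \<Rightarrow> B \<union> C) \<in> {B. B \<subseteq> S \<union> T \<and> P (B \<inter> S) \<and> Q (B \<inter> T)}"
      using BC eq by auto
    have fin': "finite B" "finite C" using BC assms by (auto intro: finite_subset)
    have "card (B \<union> C) = card B + card C"
      using fin' BC assms(3) by (intro card_Un_disjoint) blast+
    moreover have "S \<union> T - (B \<union> C) = (S - B) \<union> (T - C)" using BC assms(3) by blast
    moreover have "card ((S - B) \<union> (T - C)) = card (S - B) + card (T - C)"
      using assms by (intro card_Un_disjoint) auto
    ultimately show "subset_weight p (S \<union> T) (case BC of (B, C) \<Rightarrow> B \<union> C)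
        = (case BC of (B, C) \<Rightarrow> subset_weight p S B * subset_weight p T C)"
      using BC by (simp add: subset_weight_def power_add)
  qed auto
  finally show ?thesis ..
qed

lemma sum_subset_weight_card:
  assumes "finite S"
  shows "(\<Sum>B | B \<subseteq> S \<and> card B \<in> J. subset_weight p S B) = (\<Sum>j\<in>J \<inter> {..card S}. binom_prob (card S) p j)"
proof -
  have "(\<Sum>B | B \<subseteq> S \<and> card B \<in> J. subset_weight p S B)
      = (\<Sum>j\<in>J \<inter> {..card S}. \<Sum>B | B \<in> {B. B \<subseteq> S \<and> card B \<in> J} \<and> card B = j. subset_weight p S B)"
    using assms by (intro sum.group[symmetric]) (auto intro: card_mono)
  also have "\<dots> = (\<Sum>j\<in>J \<inter> {..card S}. binom_prob (card S) p j)"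
  proof (rule sum.cong)
    fix j assume j: "j \<in> J \<inter> {..card S}"
    have "(\<Sum>B | B \<in> {B. B \<subseteq> S \<and> card B \<in> J} \<and> card B = j. subset_weight p S B)
        = (\<Sum>B | B \<subseteq> S \<and> card B = j. p ^ j * (1 - p) ^ (card S - j))"
      using j assms
      by (intro sum.cong) (auto simp: subset_weight_def card_Diff_subset finite_subset)
    also have "\<dots> = binom_prob (card S) p j"
      using n_subsets[OF assms, of j] by (simp add: binom_prob_def)
    finally show "(\<Sum>B | B \<in> {B. B \<subseteq> S \<and> card B \<in> J} \<and> card B = j. subset_weight p S B) = binom_prob (card S) p j" .
  qed simp
  finally show ?thesis .
qed

section \<open>The items hashed to a fixed bucket\<close>

lemma prob_space_random_hash: "0 < m \<Longrightarrow> prob_space (random_hash U m)"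
  unfolding random_hash_def
  by (intro prob_space_PiM prob_space_uniform_count_measure) (auto simp: lessThan_empty_iff)

lemma space_random_hash: "space (random_hash U m) = U \<rightarrow>\<^sub>E {..<m}"
  by (simp add: random_hash_def space_PiM space_uniform_count_measure)

text \<open>The items of \<open>T\<close> landing in a fixed bucket form a random subset containing each item
  independently with probability \<open>1 / m\<close>.\<close>

lemma random_hash_bucket:
  fixes P :: "'u set \<Rightarrow> bool"
  assumes b: "b < m" and T: "finite T" "T \<subseteq> U"
  defines "E \<equiv> {h \<in> space (random_hash U m). P {x \<in> T. h x = b}}"
  shows "E \<in> sets (random_hash U m)"
    and "measure (random_hash U m) E = (\<Sum>B | B \<subseteq> T \<and> P B. subset_weight (1 / real m) T B)"
proof -
  let ?M = "\<lambda>_::'u. uniform_count_measure {..<m}"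
  have m: "0 < m" using b by simp
  interpret product_prob_space ?M U
    by (rule product_prob_spaceI) (use m in \<open>auto intro!: prob_space_uniform_count_measure simp: lessThan_empty_iff\<close>)
  define X where "X B x = (if x \<in> B then {b} else {..<m} - {b})" for B :: "'u set" and x
  \<comment> \<open>\<open>C B\<close> is the event that exactly the items of \<open>B\<close> land
    in bucket \<open>b\<close>. It constrains only the finitely many coordinates in
    \<open>T\<close>, so its measure is a finite product even when \<open>U\<close> is
    infinite.\<close>
  define C where "C B = {h \<in> space (random_hash U m). \<forall>x\<in>T. h x \<in> X B x}" for B
  have X: "X B x \<in> sets (uniform_count_measure {..<m})" for B x
    using b by (auto simp: X_def sets_uniform_count_measure)
  have C_emb: "C B = prod_emb U ?M T (Pi\<^sub>E T (X B))" for B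
    using T by (auto simp: C_def random_hash_def prod_emb_def space_PiM Pi_iff)
  have C_sets: "C B \<in> sets (random_hash U m)" for B
    unfolding C_emb random_hash_def using T X by (intro sets_PiM_I) auto
  have C_prob: "measure (random_hash U m) (C B) = subset_weight (1 / real m) T B" if B: "B \<subseteq> T" for B
  proof -
    have "measure (random_hash U m) (C B) = (\<Prod>x\<in>T. measure (uniform_count_measure {..<m}) (X B x))"
      unfolding C_emb random_hash_def by (rule measure_PiM_emb) (use T X in auto)
    also have "\<dots> = (\<Prod>x\<in>T. if x \<in> B then 1 / real m else 1 - 1 / real m)"
    proof (rule prod.cong)
      fix x
      have "real (card ({..<m} - {b})) / real m = 1 - 1 / real m"
        using b m by (simp add: card_Diff_subset of_nat_diff field_simps)
      then show "measure (uniform_count_measure {..<m}) (X B x) = (if x \<in> B then 1 / real m else 1 - 1 / real m)"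
        using b by (simp add: X_def measure_uniform_count_measure)
    qed simp
    also have "\<dots> = subset_weight (1 / real m) T B"
    proof -
      have "T \<inter> B = B" "T \<inter> - B = T - B" using B by auto
      then show ?thesis
        using T by (simp add: prod.If_cases subset_weight_def)
    qed
    finally show ?thesis .
  qed
  have C_iff: "h \<in> C B \<longleftrightarrow> h \<in> space (random_hash U m) \<and> {x \<in> T. h x = b} = B" if "B \<subseteq> T" for h B
    using that T(2) by (auto simp: C_def X_def space_random_hash split: if_splits)
  have E: "E = (\<Union>B\<in>{B. B \<subseteq> T \<and> P B}. C B)"
  proof (intro set_eqI iffI)
    fix h assume h: "h \<in> E"
    then have "h \<in> C {x \<in> T. h x = b}" by (subst C_iff) (auto simp: E_def)
    moreover have "{x \<in> T. h x = b} \<in> {B. B \<subseteq> T \<and> P B}" using h by (auto simp: E_def)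
    ultimately show "h \<in> (\<Union>B\<in>{B. B \<subseteq> T \<and> P B}. C B)" by blast
  next
    fix h assume "h \<in> (\<Union>B\<in>{B. B \<subseteq> T \<and> P B}. C B)"
    then show "h \<in> E" by (auto simp: C_iff E_def)
  qed
  have fin: "finite {B. B \<subseteq> T \<and> P B}" using T by simp
  show "E \<in> sets (random_hash U m)"
    unfolding E using fin C_sets by (intro sets.finite_UN) auto
  interpret H: prob_space "random_hash U m" using m by (rule prob_space_random_hash)
  have "measure (random_hash U m) E = (\<Sum>B | B \<subseteq> T \<and> P B. measure (random_hash U m) (C B))"
    unfolding E using fin C_sets
    by (intro H.finite_measure_finite_Union) (auto simp: disjoint_family_on_def C_iff)
  then show "measure (random_hash U m) E = (\<Sum>B | B \<subseteq> T \<and> P B. subset_weight (1 / real m) T B)"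
    using C_prob by simp
qed

lemma sum_subset_weight_blocks:
  assumes "finite I" and "\<And>i. i \<in> I \<Longrightarrow> finite (S i)" and "disjoint_family_on S I"
  shows "(\<Sum>B | B \<subseteq> (\<Union>i\<in>I. S i) \<and> (\<forall>i\<in>I. P (B \<inter> S i)). subset_weight p (\<Union>i\<in>I. S i) B)
    = (\<Prod>i\<in>I. \<Sum>B | B \<subseteq> S i \<and> P B. subset_weight p (S i) B)"
  using assms
proof (induction I rule: finite_induct)
  case empty
  have "{B. B = {} \<and> True} = {{}}" by auto
  then show ?case by (simp add: subset_weight_def)
next
  case (insert j I)
  let ?T = "\<Union>i\<in>I. S i"
  have disj: "S j \<inter> ?T = {}" "disjoint_family_on S I"
    using insert by (auto simp: disjoint_family_on_def)
  have "{B. B \<subseteq> (\<Union>i\<in>insert j I. S i) \<and> (\<forall>i\<in>insert j I. P (B \<inter> S i))}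
     = {B. B \<subseteq> S j \<union> ?T \<and> P (B \<inter> S j) \<and> (\<forall>i\<in>I. P ((B \<inter> ?T) \<inter> S i))}"
  proof -
    have "B \<inter> ?T \<inter> S i = B \<inter> S i" if "i \<in> I" for B i using that by auto
    then show ?thesis by auto
  qed
  then have "(\<Sum>B | B \<subseteq> (\<Union>i\<in>insert j I. S i) \<and> (\<forall>i\<in>insert j I. P (B \<inter> S i)). subset_weight p (\<Union>i\<in>insert j I. S i) B)
    = (\<Sum>B | B \<subseteq> S j \<union> ?T \<and> P (B \<inter> S j) \<and> (\<forall>i\<in>I. P ((B \<inter> ?T) \<inter> S i)). subset_weight p (S j \<union> ?T) B)"
    by simp
  also have "\<dots> = (\<Sum>B | B \<subseteq> S j \<and> P B. subset_weight p (S j) B)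
      * (\<Sum>B | B \<subseteq> ?T \<and> (\<forall>i\<in>I. P (B \<inter> S i)). subset_weight p ?T B)"
    using insert.hyps(1) insert.prems(1) disj(1)
    by (intro sum_subset_weight_union[where Q = "\<lambda>B. \<forall>i\<in>I. P (B \<inter> S i)"]) auto
  finally show ?case
    using insert disj by simp
qed

text \<open>Disjoint blocks put independent binomial loads into one fixed bucket, so the
  probabilities of not overflowing multiply.\<close>

lemma prob_never_overloaded:
  fixes a :: nat
  assumes b: "b < m" and I: "finite I" and n: "\<And>i. i \<in> I \<Longrightarrow> finite (S i) \<and> card (S i) = n"
    and U: "\<And>i. i \<in> I \<Longrightarrow> S i \<subseteq> U" and disj: "disjoint_family_on S I"
  defines "E \<equiv> {h \<in> space (random_hash U m). \<forall>i\<in>I. \<not> overloads a h b (S i)}"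
  shows "E \<in> sets (random_hash U m)"
    and "measure (random_hash U m) E = (1 - (\<Sum>j\<in>{a<..n}. binom_prob n (1 / real m) j)) ^ card I"
proof -
  let ?T = "\<Union>i\<in>I. S i"
  have T: "finite ?T" "?T \<subseteq> U" using I n U by auto
  have "{x \<in> ?T. h x = b} \<inter> S i = {x \<in> S i. h x = b}" if "i \<in> I" for h i using that by auto
  then have E: "E = {h \<in> space (random_hash U m). \<forall>i\<in>I. card ({x \<in> ?T. h x = b} \<inter> S i) \<in> {..a}}"
    by (auto simp: E_def overloads_def not_less)
  show "E \<in> sets (random_hash U m)"
    unfolding E by (rule random_hash_bucket(1)[OF b T, where P = "\<lambda>B. \<forall>i\<in>I. card (B \<inter> S i) \<in> {..a}"])
  have "measure (random_hash U m) E
      = (\<Sum>B | B \<subseteq> ?T \<and> (\<forall>i\<in>I. card (B \<inter> S i) \<in> {..a}). subset_weight (1 / real m) ?T B)"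
    unfolding E by (rule random_hash_bucket(2)[OF b T, where P = "\<lambda>B. \<forall>i\<in>I. card (B \<inter> S i) \<in> {..a}"])
  also have "\<dots> = (\<Prod>i\<in>I. \<Sum>B | B \<subseteq> S i \<and> card B \<in> {..a}. subset_weight (1 / real m) (S i) B)"
    by (rule sum_subset_weight_blocks) (use I n disj in auto)
  also have "\<dots> = (\<Prod>i\<in>I. \<Sum>j\<in>{..a} \<inter> {..n}. binom_prob n (1 / real m) j)"
    by (rule prod.cong) (use n sum_subset_weight_card in metis)+
  also have "(\<Sum>j\<in>{..a} \<inter> {..n}. binom_prob n (1 / real m) j) = 1 - (\<Sum>j\<in>{a<..n}. binom_prob n (1 / real m) j)"
  proof -
    have "{..n} = ({..a} \<inter> {..n}) \<union> {a<..n}" by auto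
    then have "(\<Sum>j\<le>n. binom_prob n (1 / real m) j)
        = (\<Sum>j\<in>{..a} \<inter> {..n}. binom_prob n (1 / real m) j) + (\<Sum>j\<in>{a<..n}. binom_prob n (1 / real m) j)"
      by (metis (no_types, lifting) sum.union_disjoint finite_Int finite_atMost finite_greaterThanAtMost
          disjoint_iff IntE atMost_iff greaterThanAtMost_iff leD)
    then show ?thesis using sum_binom_prob[of n "1 / real m"] by simp
  qed
  finally show "measure (random_hash U m) E = (1 - (\<Sum>j\<in>{a<..n}. binom_prob n (1 / real m) j)) ^ card I"
    by simp
qed

text \<open>Markov's inequality for the number of events that occur. It requires no independence,
  which matters because the loads of different buckets are dependent.\<close>

lemma (in prob_space) prob_many_events_le:
  assumes B: "finite B" "B \<noteq> {}" and E: "\<And>b. b \<in> B \<Longrightarrow> E b \<in> events" "\<And>b. b \<in> B \<Longrightarrow> prob (E b) \<le> \<epsilon>"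
    and \<theta>: "0 < \<theta>"
  shows "{\<omega> \<in> space M. \<theta> * real (card B) \<le> real (card {b \<in> B. \<omega> \<in> E b})} \<in> events"
    and "prob {\<omega> \<in> space M. \<theta> * real (card B) \<le> real (card {b \<in> B. \<omega> \<in> E b})} \<le> \<epsilon> / \<theta>"
proof -
  have c: "0 < card B" using B by (simp add: card_gt_0_iff)
  define Z where "Z \<omega> = (\<Sum>b\<in>B. indicator (E b) \<omega> :: real)" for \<omega>
  have Z: "real (card {b \<in> B. \<omega> \<in> E b}) = Z \<omega>" for \<omega>
    using B by (simp add: Z_def indicator_def sum.If_cases Int_def)
  have int: "integrable M Z"
    unfolding Z_def using E by (intro Bochner_Integration.integrable_sum) (simp add: emeasure_eq_measure)
  show "{\<omega> \<in> space M. \<theta> * real (card B) \<le> real (card {b \<in> B. \<omega> \<in> E b})} \<in> events"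
    unfolding Z using borel_measurable_integrable[OF int] by measurable
  have "prob {\<omega> \<in> space M. \<theta> * real (card B) \<le> Z \<omega>} \<le> expectation Z / (\<theta> * real (card B))"
    by (rule integral_Markov_inequality_measure[OF int, where A = "{}"])
       (use \<theta> c in \<open>auto simp: Z_def sum_nonneg\<close>)
  also have "expectation Z = (\<Sum>b\<in>B. prob (E b))"
    unfolding Z_def using E by (subst Bochner_Integration.integral_sum) (auto simp: emeasure_eq_measure)
  also have "\<dots> \<le> real (card B) * \<epsilon>"
    using E(2) by (rule sum_bounded_above)
  finally have "prob {\<omega> \<in> space M. \<theta> * real (card B) \<le> Z \<omega>} \<le> real (card B) * \<epsilon> / (\<theta> * real (card B))"
    using \<theta> c by (simp add: divide_right_mono)
  then show "prob {\<omega> \<in> space M. \<theta> * real (card B) \<le> real (card {b \<in> B. \<omega> \<in> E b})} \<le> \<epsilon> / \<theta>"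
    unfolding Z using c by simp
qed

section \<open>The lower bound\<close>

text \<open>Change of measure from \<open>p = 1 / m\<close> to
  \<open>r = a / n = p / (1 - \<delta>)\<close>, which has integer mean \<open>a\<close>. The
  divergence over \<open>n\<close> trials is
  \<open>inverse (1 - \<delta>) * \<delta>\<^sup>2 * a / (1 - p)\<close>; \<open>m \<ge> 2\<close>
  makes the last factor at most 2, and 4/81 is the square of 2/9.\<close>

lemma binom_prob_overload_ge:
  fixes \<delta> :: real
  assumes a: "0 < a" "2 * a \<le> n" and m: "2 \<le> m"
    and \<delta>: "\<delta> < 1" "real n = (1 - \<delta>) * real (a * m)"
  shows "4 / 81 * exp (- 2 * (inverse (1 - \<delta>) * \<delta>\<^sup>2 * real a)) \<le> (\<Sum>j\<in>{a<..n}. binom_prob n (1 / real m) j)"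
    (is "_ \<le> ?q")
proof -
  define p r where "p = 1 / real m" and "r = real a / real n"
  define x where "x = (r - p)\<^sup>2 / (p * (1 - p))"
  have p: "0 < p" "p \<le> 1 / 2" using m by (auto simp: p_def field_simps)
  have r: "0 \<le> r" "r \<le> 1" using a by (auto simp: r_def)
  have x0: "0 \<le> x" using p by (simp add: x_def)
  have "r = p / (1 - \<delta>)"
    unfolding r_def p_def \<delta>(2) using a(1) by simp
  then have rp: "r - p = p * \<delta> / (1 - \<delta>)"
    using \<delta>(1) by (simp add: field_simps)
  have np: "real n * p = (1 - \<delta>) * real a" using m \<delta> by (simp add: p_def field_simps)
  have "real n * x = (real n * p) * \<delta>\<^sup>2 / ((1 - \<delta>)\<^sup>2 * (1 - p))"
    using p by (simp add: x_def rp power_divide power_mult_distrib power2_eq_square mult_ac)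
  also have "\<dots> = (inverse (1 - \<delta>) * \<delta>\<^sup>2 * real a) * (1 / (1 - p))"
  proof -
    have "(u * y) * d / (u\<^sup>2 * w) = (inverse u * d * y) * (1 / w)" if "0 < u" "0 < w" for u w y d :: real
      using that by (simp add: power2_eq_square field_simps)
    then show ?thesis using \<delta>(1) p unfolding np by simp
  qed
  also have "\<dots> \<le> (inverse (1 - \<delta>) * \<delta>\<^sup>2 * real a) * 2"
    using p \<delta> by (intro mult_left_mono) (auto simp: field_simps)
  finally have nx: "real n * x \<le> 2 * (inverse (1 - \<delta>) * \<delta>\<^sup>2 * real a)" by simp
  have "(1 + x) ^ n \<le> exp x ^ n" using x0 by (intro power_mono exp_ge_add_one_self) auto
  also have "\<dots> = exp (real n * x)" by (simp add: exp_of_nat_mult)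
  also have "\<dots> \<le> exp (2 * (inverse (1 - \<delta>) * \<delta>\<^sup>2 * real a))" (is "_ \<le> ?e") using nx by simp
  finally have e: "(1 + x) ^ n \<le> ?e" .
  have q0: "0 \<le> ?q" using p by (intro sum_nonneg binom_prob_nonneg) (auto simp: p_def)
  have "(2 / 9)\<^sup>2 \<le> (\<Sum>j\<in>{a<..n}. binom_prob n r j)\<^sup>2"
    unfolding r_def by (intro power_mono binom_prob_tail_integer_mean a) auto
  also have "\<dots> \<le> ?q * (1 + x) ^ n"
    unfolding x_def p_def[symmetric] by (rule binom_prob_tail_change_of_measure) (use p r in auto)
  also have "\<dots> \<le> ?q * ?e"
    using e q0 by (rule mult_left_mono)
  finally have "4 / 81 \<le> ?q * ?e" by (simp add: power2_eq_square)
  then have "4 / 81 / ?e \<le> ?q" by (simp add: pos_divide_le_eq)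
  moreover have "4 / 81 / ?e = 4 / 81 * exp (- 2 * (inverse (1 - \<delta>) * \<delta>\<^sup>2 * real a))"
    by (simp only: mult_minus_left exp_minus divide_inverse)
  ultimately show ?thesis by simp
qed

text \<open>The first five Taylor terms of the exponential at 20/27 already exceed 25/12. The value
  20/27 is 15 times 4/81, the expected number of overloads guaranteed below.\<close>

lemma exp_minus_20_27: "exp (- (20 / 27)) \<le> (12 / 25 :: real)"
proof -
  have "(\<Sum>i<5. (20 / 27) ^ i /\<^sub>R fact i) \<le> exp (20 / 27 :: real)"
    unfolding exp_def by (rule sum_le_suminf[OF summable_exp_generic]) auto
  then have "25 / 12 \<le> exp (20 / 27 :: real)"
    by (simp add: eval_nat_numeral fact_numeral field_simps)
  then show ?thesis by (simp add: exp_minus field_simps)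
qed

lemma set_associative_hard_sequence:
  fixes A :: "nat \<Rightarrow> 'u caching" and \<delta> c D :: real
  assumes A: "paging_algorithm A" "conservative A"
    and a: "0 < a" and m: "2 \<le> m" and k: "k = a * m"
    and \<delta>: "0 \<le> \<delta>" "\<delta> < 1" and k': "real k' = (1 - \<delta>) * real k" "2 * a \<le> k'"
    and c: "1 \<le> c" and D: "D \<le> real k"
    and U: "infinite U \<or> 16 * real k * exp (8 * inverse (1 - \<delta>) * \<delta>\<^sup>2 * real a) \<le> real (card U)"
  shows "\<exists>\<sigma>. set \<sigma> \<subseteq> U
    \<and> real (length \<sigma>) \<le> 20000 * (c * real a * real k * exp (16 * inverse (1 - \<delta>) * \<delta>\<^sup>2 * real a))
    \<and> measure (random_hash U m) {h \<in> space (random_hash U m).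
        real (misses (set_associative A a k h) \<sigma>) \<le> c * real (misses (A k') \<sigma>) + D} < 1 / 2"
proof -
  define e where "e = inverse (1 - \<delta>) * \<delta>\<^sup>2 * real a"
  have e0: "0 \<le> e" using \<delta> by (simp add: e_def)
  \<comment> \<open>The number of items that \<open>U\<close> is guaranteed to offer;
    \<open>N\<close> is the number of disjoint blocks of size \<open>k'\<close> that they
    fill.\<close>
  define V where "V = 16 * real k * exp (8 * e)"
  define N where "N = nat \<lfloor>V / real k'\<rfloor>"
  have k'0: "0 < k'" and k0: "0 < k" using a k'(2) k m by auto
  have k'k: "real k' \<le> real k" using k'(1) \<delta> by (simp add: mult_left_le_one_le)
  have V16: "16 * real k \<le> V" using e0 k0 by (simp add: V_def)
  have N_le: "real N \<le> V / real k'" using V16 k0 by (simp add: N_def)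
  then have NkV: "real (N * k') \<le> V" using k'0 by (simp add: field_simps)
  \<comment> \<open>Rounding down costs less than 1, which one of the 16 copies of
    \<open>exp (8 * e)\<close> pays for.\<close>
  have N_ge: "15 * exp (8 * e) \<le> real N"
  proof -
    have "16 * exp (8 * e) * real k' \<le> V"
      unfolding V_def using k'k by simp
    then have "16 * exp (8 * e) \<le> V / real k'" using k'0 by (simp add: pos_le_divide_eq)
    moreover have "V / real k' < real N + 1" using V16 k0 by (simp add: N_def)
    moreover have "1 \<le> exp (8 * e)" using e0 by simp
    ultimately show ?thesis by linarith
  qed
  define q where "q = (\<Sum>j\<in>{a<..k'}. binom_prob k' (1 / real m) j)"
  have q_ge: "4 / 81 * exp (- 2 * e) \<le> q"
    unfolding q_def e_def using a k' m \<delta> k by (intro binom_prob_overload_ge) auto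
  have "q \<le> (\<Sum>j\<le>k'. binom_prob k' (1 / real m) j)"
    unfolding q_def using m by (intro sum_mono2 binom_prob_nonneg) auto
  then have q1: "q \<le> 1" by (simp add: sum_binom_prob)
  have Nq: "20 / 27 \<le> real N * q"
  proof -
    have "20 / 27 \<le> 20 / 27 * exp (6 * e)" using e0 by simp
    also have "\<dots> = (15 * exp (8 * e)) * (4 / 81 * exp (- 2 * e))"
      by (simp flip: exp_add)
    also have "\<dots> \<le> real N * q"
      using N_ge q_ge by (intro mult_mono) auto
    finally show ?thesis .
  qed
  have "1 - q \<le> exp (- q)" using exp_ge_add_one_self[of "- q"] by simp
  then have "(1 - q) ^ N \<le> exp (- q) ^ N" using q1 by (intro power_mono) auto
  also have "\<dots> = exp (- (real N * q))" by (simp flip: exp_of_nat_mult)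
  also have "\<dots> \<le> exp (- (20 / 27))" using Nq by simp
  finally have eps: "(1 - q) ^ N \<le> 12 / 25" using exp_minus_20_27 by linarith

  obtain W where W: "W \<subseteq> U" "finite W" "card W = N * k'"
  proof (cases "finite U")
    case True
    then have "V \<le> real (card U)" using U by (simp add: V_def e_def mult.assoc)
    then have "real (N * k') \<le> real (card U)" using NkV by linarith
    then have "N * k' \<le> card U" by (simp only: of_nat_le_iff)
    then show ?thesis using that obtain_subset_with_card_n by metis
  next
    case False
    then show ?thesis using that infinite_arbitrarily_large by metis
  qed
  obtain f where f: "bij_betw f {..<N * k'} W"
    using ex_bij_betw_nat_finite[OF W(2)] W(3) by (auto simp: atLeast0LessThan)
  have f_inj: "inj_on f {..<N * k'}" and f_img: "f ` {..<N * k'} = W"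
    using f by (auto simp: bij_betw_def)
  define J where "J i = {i * k'..<Suc i * k'}" for i
  define \<tau> where "\<tau> i = map f [i * k'..<Suc i * k']" for i
  have set_\<tau>: "set (\<tau> i) = f ` J i" for i by (simp add: \<tau>_def J_def)
  have J_sub: "J i \<subseteq> {..<N * k'}" if "i < N" for i
  proof -
    have "Suc i * k' \<le> N * k'" using that by (intro mult_le_mono1) simp
    then show ?thesis by (auto simp: J_def)
  qed
  have \<tau>_W: "set (\<tau> i) \<subseteq> U" if "i < N" for i
    using J_sub[OF that] f_img W(1) by (auto simp: set_\<tau>)
  have \<tau>_dist: "distinct (\<tau> i)" if "i < N" for i
    using inj_on_subset[OF f_inj J_sub[OF that]] by (simp add: \<tau>_def J_def distinct_map)
  have \<tau>_len: "length (\<tau> i) = k'" for i by (simp add: \<tau>_def)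
  have \<tau>_disj: "disjoint_family_on (\<lambda>i. set (\<tau> i)) {..<N}"
    unfolding disjoint_family_on_def
  proof (intro ballI impI)
    fix i j assume ij: "i \<in> {..<N}" "j \<in> {..<N}" "i \<noteq> j"
    have "x div k' = l" if "x \<in> J l" for x l
      using that by (intro div_nat_eqI) (auto simp: J_def mult.commute)
    then have "J i \<inter> J j = {}" using ij(3) by blast
    then show "set (\<tau> i) \<inter> set (\<tau> j) = {}"
      using ij J_sub f_inj by (auto simp: set_\<tau> dest!: inj_onD)
  qed

  \<comment> \<open>Solves \<open>X * (3 * m / 100) = c * N * k' + D\<close>: beyond
    \<open>X\<close> passes, more than three percent overloaded buckets break the allowance. In
    \<open>R\<close>, \<open>nat\<close> covers a negative \<open>D\<close>, and \<open>Suc\<close>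
    makes \<open>R\<close> positive so that it can be cancelled.\<close>
  define X where "X = 100 * (c * real (N * k') + D) / (3 * real m)"
  define R where "R = Suc (nat \<lceil>X\<rceil>)"
  define \<sigma> where "\<sigma> = cycle_blocks R (map \<tau> [0..<N])"
  have \<sigma>_U: "set \<sigma> \<subseteq> U"
    using set_cycle_blocks[of R "map \<tau> [0..<N]"] \<tau>_W by (fastforce simp: \<sigma>_def)
  have "length \<sigma> = N * (R * k')"
    unfolding \<sigma>_def by (subst length_cycle_blocks[where n = k']) (auto simp: \<tau>_len)
  then have "real (length \<sigma>) = real (N * k') * real R" by simp
  \<comment> \<open>\<open>X\<close> contributes 3200/3, and rounding up plus \<open>Suc\<close>
    contributes 2, absorbed as 6/3. One factor \<open>exp (8 * e)\<close> comes from the number of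
    items and one from \<open>R\<close>, which explains the exponent 16 in the length bound.\<close>
  also have "\<dots> \<le> V * (c * real a * exp (8 * e) * (3206 / 3))"
  proof (rule mult_mono[OF NkV])
    have ge1: "1 \<le> c * real a * exp (8 * e)"
      using c a e0 by (intro mult_ge1_I) auto
    have "c * real (N * k') + D \<le> c * V + c * V"
    proof (rule add_mono)
      show "c * real (N * k') \<le> c * V" using NkV c by (intro mult_left_mono) auto
      have "1 * V \<le> c * V" using c V16 k0 by (intro mult_right_mono) auto
      then show "D \<le> c * V" using D V16 by linarith
    qed
    then have "100 * (c * real (N * k') + D) \<le> 100 * (2 * (c * V))"
      by (simp add: algebra_simps)
    then have "X \<le> 100 * (2 * (c * V)) / (3 * real m)"
      unfolding X_def by (rule divide_right_mono) simp
    also have "\<dots> = c * real a * exp (8 * e) * (3200 / 3)"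
      using m by (simp add: V_def k field_simps)
    finally have X: "X \<le> c * real a * exp (8 * e) * (3200 / 3)" .
    have "real R \<le> max 0 X + 2" unfolding R_def by linarith
    also have "\<dots> \<le> c * real a * exp (8 * e) * (3206 / 3)"
      using X ge1 by linarith
    finally show "real R \<le> c * real a * exp (8 * e) * (3206 / 3)" .
  qed (use V16 in auto)
  also have "\<dots> = (16 * 3206 / 3) * (c * real a * real k * (exp (8 * e) * exp (8 * e)))"
    by (simp add: V_def)
  also have "\<dots> \<le> 20000 * (c * real a * real k * (exp (8 * e) * exp (8 * e)))"
    using c by (intro mult_right_mono) auto
  also have "exp (8 * e) * exp (8 * e) = exp (16 * inverse (1 - \<delta>) * \<delta>\<^sup>2 * real a)"
    by (simp add: e_def mult.assoc flip: exp_add)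
  finally have \<sigma>_len: "real (length \<sigma>) \<le> 20000 * (c * real a * real k * exp (16 * inverse (1 - \<delta>) * \<delta>\<^sup>2 * real a))" .

  have "misses (A k') \<sigma> \<le> length (map \<tau> [0..<N]) * k'"
    unfolding \<sigma>_def by (rule conservative_cycle_blocks[OF A(2) k'0]) (auto simp: \<tau>_len)
  then have opt: "misses (A k') \<sigma> \<le> N * k'" by simp
  define H where "H = random_hash U m"
  interpret H: prob_space H unfolding H_def using m by (intro prob_space_random_hash) simp
  define E where "E b = {h \<in> space H. \<forall>i\<in>{..<N}. \<not> overloads a h b (set (\<tau> i))}" for b
  have E: "E b \<in> H.events" "H.prob (E b) \<le> 12 / 25" if "b \<in> {..<m}" for b
  proof -
    have card_\<tau>: "finite (set (\<tau> i)) \<and> card (set (\<tau> i)) = k'" if "i \<in> {..<N}" for i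
      using \<tau>_dist[of i] that by (simp add: distinct_card \<tau>_len)
    note never = prob_never_overloaded[OF _ finite_lessThan card_\<tau> _ \<tau>_disj, of b m U a]
    show "E b \<in> H.events" unfolding E_def H_def using \<tau>_W that by (intro never) auto
    show "H.prob (E b) \<le> 12 / 25" 
      unfolding E_def H_def using \<tau>_W that eps by (subst never) (auto simp: q_def)
  qed
  have km: "k div a = m" using k a by simp
  let ?few = "{h \<in> space H. 97 / 100 * real (card {..<m}) \<le> real (card {b \<in> {..<m}. h \<in> E b})}"
  let ?good = "{h \<in> space H. real (misses (set_associative A a k h) \<sigma>) \<le> c * real (misses (A k') \<sigma>) + D}"
  \<comment> \<open>If the competitive bound holds, at most \<open>3 * m / 100\<close> buckets can
    be overloaded, so at least 97 percent never are.\<close>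
  have sub: "?good \<subseteq> ?few"
  proof (intro subsetI CollectI conjI)
    fix h assume "h \<in> ?good"
    then have h: "h \<in> space H"
      and le: "real (misses (set_associative A a k h) \<sigma>) \<le> c * real (misses (A k') \<sigma>) + D" by auto
    show "h \<in> space H" by (rule h)
    let ?B = "{b. b < k div a \<and> (\<exists>\<tau>\<in>set (map \<tau> [0..<N]). overloads a h b (set \<tau>))}"
    have "R * card ?B \<le> misses (set_associative A a k h) \<sigma>"
      unfolding \<sigma>_def
    proof (rule misses_set_associative_cycle_blocks[OF A(1) a])
      fix \<rho> assume "\<rho> \<in> set (map \<tau> [0..<N])"
      then show "distinct \<rho>" using \<tau>_dist by auto
    next
      fix \<rho> x assume "\<rho> \<in> set (map \<tau> [0..<N])" "x \<in> set \<rho>"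
      then obtain i where "i < N" "x \<in> set (\<tau> i)" by auto
      then have "x \<in> U" using \<tau>_W by blast
      then show "h x < k div a" using h unfolding km H_def space_random_hash by auto
    qed
    then have "real R * real (card ?B) \<le> real (misses (set_associative A a k h) \<sigma>)"
      unfolding of_nat_mult[symmetric] by (rule of_nat_mono)
    also have "\<dots> \<le> c * real (misses (A k') \<sigma>) + D" by (rule le)
    also have "\<dots> \<le> c * real (N * k') + D"
      using opt c by (intro add_right_mono mult_left_mono of_nat_mono) auto
    also have "\<dots> = X * (3 / 100 * real m)" using m by (simp add: X_def)
    also have "\<dots> \<le> real R * (3 / 100 * real m)"
      unfolding R_def by (intro mult_right_mono) (linarith, simp)
    finally have B: "real (card ?B) \<le> 3 / 100 * real m" by (simp add: R_def)
    have "{..<m} = {b \<in> {..<m}. h \<in> E b} \<union> ?B" using h unfolding km E_def by auto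
    then have "m \<le> card {b \<in> {..<m}. h \<in> E b} + card ?B"
      using card_Un_le[of "{b \<in> {..<m}. h \<in> E b}" ?B] by (metis card_lessThan)
    then have "real m \<le> real (card {b \<in> {..<m}. h \<in> E b}) + real (card ?B)"
      unfolding of_nat_add[symmetric] by (rule of_nat_mono)
    with B show "97 / 100 * real (card {..<m}) \<le> real (card {b \<in> {..<m}. h \<in> E b})" by simp
  qed
  have ne: "{..<m} \<noteq> {}" using m by (auto simp: lessThan_empty_iff)
  have \<theta>: "0 < (97 / 100 :: real)" by simp
  note few = H.prob_many_events_le[OF finite_lessThan ne E \<theta>]
  \<comment> \<open>Measurability of the larger event suffices: a nonmeasurable set would have
    measure 0. The resulting bound is 48/97.\<close>
  have "H.prob ?good \<le> H.prob ?few"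
    by (rule H.finite_measure_mono[OF sub few(1)])
  also have "\<dots> \<le> (12 / 25) / (97 / 100)"
    by (rule few(2))
  also have "\<dots> < 1 / 2" by simp
  finally show ?thesis using \<sigma>_U \<sigma>_len unfolding H_def by blast
qed

theorem theorem8:
  fixes A :: "nat \<Rightarrow> 'u caching"
    and U :: "nat \<Rightarrow> 'u set"
    and \<alpha> :: "nat \<Rightarrow> nat"
    and \<delta> :: "nat \<Rightarrow> real"
  assumes "paging_algorithm A" and "conservative A"
    and "\<And>k. \<alpha> k dvd k"
    and "\<And>k. 0 \<le> \<delta> k" and "\<And>k. \<delta> k < 1"
    and "\<exists>\<^sub>F k in sequentially. \<exists>k'::nat. real k = inverse (1 - \<delta> k) * real k'"
    and "\<forall>\<^sub>F k in sequentially. infinite (U k) \<or>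
           real (card (U k)) \<ge> 16 * real k * exp (8 * inverse (1 - \<delta> k) * (\<delta> k)\<^sup>2 * real (\<alpha> k))"
    and "\<forall>\<^sub>F k in sequentially. inverse (1 - \<delta> k) \<le> real k / (2 * real (\<alpha> k))"
  shows "\<exists>L>0. \<forall>c\<ge>1. not_competitive U
           (\<lambda>k. random_hash (U k) (k div \<alpha> k)) (\<lambda>k. set_associative A (\<alpha> k) k) A
           c (\<lambda>k. inverse (1 - \<delta> k))
           (\<lambda>k. L * (c * real (\<alpha> k) * real k *
                  exp (16 * inverse (1 - \<delta> k) * (\<delta> k)\<^sup>2 * real (\<alpha> k))))"
\<comment> \<open>The constant is chosen before \<open>c\<close>, which enters the length only as an
  explicit factor.\<close>
proof (intro exI[of _ "20000::real"] conjI allI impI)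
  fix c :: real assume c: "1 \<le> c"
  show "not_competitive U
           (\<lambda>k. random_hash (U k) (k div \<alpha> k)) (\<lambda>k. set_associative A (\<alpha> k) k) A
           c (\<lambda>k. inverse (1 - \<delta> k))
           (\<lambda>k. 20000 * (c * real (\<alpha> k) * real k *
                  exp (16 * inverse (1 - \<delta> k) * (\<delta> k)\<^sup>2 * real (\<alpha> k))))"
    unfolding not_competitive_def
  proof
    assume "competitive_with_prob U
           (\<lambda>k. random_hash (U k) (k div \<alpha> k)) (\<lambda>k. set_associative A (\<alpha> k) k) A
           c (1 / 2) (\<lambda>k. inverse (1 - \<delta> k))
           (\<lambda>k. 20000 * (c * real (\<alpha> k) * real k *
                  exp (16 * inverse (1 - \<delta> k) * (\<delta> k)\<^sup>2 * real (\<alpha> k))))"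
    then obtain D where "\<forall>\<^sub>F k in sequentially. \<forall>k'. real k = inverse (1 - \<delta> k) * real k' \<longrightarrow>
        (\<forall>\<sigma>. set \<sigma> \<subseteq> U k \<and> real (length \<sigma>) \<le> 20000 * (c * real (\<alpha> k) * real k *
                  exp (16 * inverse (1 - \<delta> k) * (\<delta> k)\<^sup>2 * real (\<alpha> k))) \<longrightarrow>
           measure (random_hash (U k) (k div \<alpha> k)) {\<omega> \<in> space (random_hash (U k) (k div \<alpha> k)).
             real (misses (set_associative A (\<alpha> k) k \<omega>) \<sigma>) \<le> c * real (misses (A k') \<sigma>) + D} \<ge> 1 / 2)"
      (is "eventually ?comp _")
      unfolding competitive_with_prob_def by blast
    \<comment> \<open>\<open>D\<close> is independent of \<open>k\<close>, so for large
      \<open>k\<close> it is absorbed into the scale of the sequence.\<close>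
    moreover have "\<forall>\<^sub>F k in sequentially. D \<le> real k"
      using filterlim_real_sequentially unfolding filterlim_at_top by blast
    \<comment> \<open>Integral \<open>k'\<close> exist only for infinitely many \<open>k\<close>,
      not for all large ones. The implication form lets the frequent condition meet the eventual
      ones at a single \<open>k\<close>.\<close>
    ultimately have "\<forall>\<^sub>F k in sequentially. (\<exists>k'::nat. real k = inverse (1 - \<delta> k) * real k') \<longrightarrow>
        (\<exists>k'::nat. real k = inverse (1 - \<delta> k) * real k') \<and> ?comp k \<and> D \<le> real k \<and> 0 < k
        \<and> inverse (1 - \<delta> k) \<le> real k / (2 * real (\<alpha> k))
        \<and> (infinite (U k) \<or> real (card (U k)) \<ge> 16 * real k * exp (8 * inverse (1 - \<delta> k) * (\<delta> k)\<^sup>2 * real (\<alpha> k)))"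
      using assms(7,8) eventually_gt_at_top[of 0] by eventually_elim blast
    from frequently_ex[OF frequently_rev_mp[OF assms(6) this]]
    obtain k k' where kk': "real k = inverse (1 - \<delta> k) * real k'" and comp: "?comp k"
      and k: "D \<le> real k" "0 < k"
      and aug: "inverse (1 - \<delta> k) \<le> real k / (2 * real (\<alpha> k))"
      and card_U: "infinite (U k) \<or> real (card (U k)) \<ge> 16 * real k * exp (8 * inverse (1 - \<delta> k) * (\<delta> k)\<^sup>2 * real (\<alpha> k))"
      by blast
    have \<delta>: "0 \<le> \<delta> k" "\<delta> k < 1" by (rule assms)+
    have \<alpha>0: "0 < \<alpha> k" using assms(3)[of k] k(2) by (auto intro!: Nat.gr0I)
    define m where "m = k div \<alpha> k"
    have km: "k = \<alpha> k * m" using assms(3)[of k] by (simp add: m_def)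
    have k': "real k' = (1 - \<delta> k) * real k" using kk' \<delta> by (simp add: field_simps)
    \<comment> \<open>The augmentation is at least 1, so its upper bound forces at least two
      buckets. Multiplied by \<open>1 - \<delta> k\<close> instead, the same bound gives
      \<open>2 * \<alpha> k \<le> k'\<close>, as needed for the integer-mean tail.\<close>
    have "1 \<le> inverse (1 - \<delta> k)" using \<delta> by (simp add: one_le_inverse_iff)
    then have "1 * (2 * real (\<alpha> k)) \<le> inverse (1 - \<delta> k) * (2 * real (\<alpha> k))"
      by (rule mult_right_mono) simp
    also have "\<dots> \<le> real k" using aug \<alpha>0 by (simp add: pos_le_divide_eq)
    finally have "2 * real (\<alpha> k) \<le> real k" by simp
    then have "2 * \<alpha> k \<le> \<alpha> k * m" using km by linarith
    then have m: "2 \<le> m" using \<alpha>0 by (simp add: mult.commute)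
    have "2 * real (\<alpha> k) \<le> real k'"
      using aug \<alpha>0 \<delta> unfolding k' by (simp add: field_simps)
    then have k'2: "2 * \<alpha> k \<le> k'" by linarith
    obtain \<sigma> where "set \<sigma> \<subseteq> U k"
      "real (length \<sigma>) \<le> 20000 * (c * real (\<alpha> k) * real k * exp (16 * inverse (1 - \<delta> k) * (\<delta> k)\<^sup>2 * real (\<alpha> k)))"
      "measure (random_hash (U k) m) {h \<in> space (random_hash (U k) m).
        real (misses (set_associative A (\<alpha> k) k h) \<sigma>) \<le> c * real (misses (A k') \<sigma>) + D} < 1 / 2"
      using set_associative_hard_sequence[OF assms(1,2) \<alpha>0 m km \<delta> k' k'2 c k(1) card_U] by blast
    with comp kk' show False unfolding m_def by (meson not_less)
  qed
qed simp

end
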